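(* Let $\mathcal{R}=\mathbb{F}_{q_1}\oplus\cdots\oplus\mathbb{F}_{q_r}$ with $r\ge1$, and let $k\ge1$. There exists a sequence $\mathbf{a}$ over $\mathcal{R}$ satisfying a linear recurrence of degree $k$ over $\mathcal{R}$ (with $c_0$ a unit) with $\rho(\mathbf{a})=|\mathcal{R}|^k-1$ if and only if $r=1$, i.e. $\mathcal{R}$ is a field.
   Context: $q_1,\dots,q_r$ are prime powers (not necessarily of the same characteristic), so $|\mathcal{R}|=q_1\cdots q_r$. A sequence $(a_n)_{n\ge0}$ over $\mathcal{R}$ satisfies a linear recurrence of degree $k$ if there are $c_0,\dots,c_{k-1}\in\mathcal{R}$ with $c_0$ a unit such that $a_{n+k}=\sum_{i=0}^{k-1}c_ia_{n+i}$ for all $n\ge0$; such sequences are purely periodic, and $\rho(\mathbf{a})$ is the least $m>0$ with $a_{n+m}=a_n$ for all $n\ge0$. *)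

theory Defs
  imports "HOL-Algebra.Chinese_Remainder"
begin

definition lin_rec :: "('a, 'm) ring_scheme \<Rightarrow> nat \<Rightarrow> (nat \<Rightarrow> 'a) \<Rightarrow> (nat \<Rightarrow> 'a) \<Rightarrow> bool" where
  "lin_rec R k c a \<longleftrightarrow>
     (\<forall>n. a n \<in> carrier R) \<and>
     (\<forall>i<k. c i \<in> carrier R) \<and>
     c 0 \<in> Units R \<and>
     (\<forall>n. a (n + k) = finsum R (\<lambda>i. c i \<otimes>\<^bsub>R\<^esub> a (n + i)) {..<k})"

definition least_period :: "(nat \<Rightarrow> 'a) \<Rightarrow> nat" where
  "least_period a = (LEAST m. 0 < m \<and> (\<forall>n. a (n + m) = a n))"

end

theory Submission
  imports Defs "HOL-Algebra.Algebraic_Closure" "HOL-Algebra.Sylow"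
begin

text \<open>
  Over a finite nontrivial ring \<open>A\<close> a window of \<open>k\<close> consecutive terms determines a recurring
  sequence in both directions, and the zero window only occurs in the zero sequence; so there is a
  period of at most \<open>|A|\<^sup>k - 1\<close>. Over a product \<open>A \<times> B\<close> of two such rings the product of periods of
  the two components is a period, and \<open>(|A|\<^sup>k - 1)(|B|\<^sup>k - 1) < |A \<times> B|\<^sup>k - 1\<close>.

  Conversely, for a field \<open>F\<close> with \<open>q\<close> elements the fixed points of \<open>x \<mapsto> x\<^bsup>N\<^esup>\<close>, \<open>N = q\<^sup>k\<close>, in the
  algebraic closure form a field with \<open>N\<close> elements. Let \<open>\<alpha>\<close> generate its multiplicative group and
  let \<open>\<phi>\<close> be a nonzero \<open>F\<close>-linear functional on it. The minimal polynomial of \<open>\<alpha>\<close> has degree \<open>k\<close>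
  and provides a linear recurrence for \<open>\<phi> (\<alpha>\<^sup>n)\<close>, whose periods are those of \<open>\<alpha>\<^sup>n\<close>.
\<close>

section \<open>Periods of linear recurring sequences\<close>

definition is_period :: "(nat \<Rightarrow> 'a) \<Rightarrow> nat \<Rightarrow> bool" where
  "is_period a m \<longleftrightarrow> 0 < m \<and> (\<forall>n. a (n + m) = a n)"

lemma least_period_eq_Least: "least_period a = (LEAST m. is_period a m)"
  by (simp add: least_period_def is_period_def)

lemma least_period_le: "is_period a m \<Longrightarrow> least_period a \<le> m"
  unfolding least_period_eq_Least by (rule Least_le)

lemma is_period_comp_inj_on:
  assumes "inj_on f A" and "\<And>n. a n \<in> A"
  shows "is_period (\<lambda>n. f (a n)) m \<longleftrightarrow> is_period a m"
  using assms by (auto simp: is_period_def inj_on_def)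

lemma is_period_mult:
  assumes "is_period a m" and "0 < l"
  shows "is_period a (m * l)"
proof -
  have "a (n + m * l) = a n" for n
  proof (induction l)
    case (Suc l)
    have "a (n + m * Suc l) = a ((n + m * l) + m)" by (simp add: algebra_simps)
    with Suc assms(1) show ?case by (simp add: is_period_def)
  qed simp
  with assms show ?thesis by (simp add: is_period_def)
qed

lemma is_period_Pair:
  assumes "is_period (\<lambda>n. fst (a n)) l" and "is_period (\<lambda>n. snd (a n)) m"
  shows "is_period a (l * m)"
proof -
  have "0 < l" and "0 < m" using assms by (simp_all add: is_period_def)
  then have "is_period (\<lambda>n. fst (a n)) (l * m)" and "is_period (\<lambda>n. snd (a n)) (l * m)"
    using is_period_mult[OF assms(1), of m] is_period_mult[OF assms(2), of l]
    by (simp_all add: mult.commute)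
  then show ?thesis by (auto simp: is_period_def prod_eq_iff)
qed

definition window :: "nat \<Rightarrow> (nat \<Rightarrow> 'a) \<Rightarrow> nat \<Rightarrow> nat \<Rightarrow> 'a" where
  "window k a n = (\<lambda>i\<in>{..<k}. a (n + i))"

lemma window_eq_iff: "window k a n = window k b m \<longleftrightarrow> (\<forall>i<k. a (n + i) = b (m + i))"
  by (auto simp: window_def fun_eq_iff)

lemma
  assumes "lin_rec R k c a"
  shows lin_rec_closed: "a n \<in> carrier R"
    and lin_rec_coeff_closed: "i < k \<Longrightarrow> c i \<in> carrier R"
    and lin_rec_coeff_Units: "c 0 \<in> Units R"
    and lin_rec_recurrence: "a (n + k) = finsum R (\<lambda>i. c i \<otimes>\<^bsub>R\<^esub> a (n + i)) {..<k}"
  using assms by (auto simp only: lin_rec_def)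

context ring
begin

lemma lin_rec_shift: "lin_rec R k c a \<Longrightarrow> lin_rec R k c (\<lambda>n. a (m + n))"
  by (simp add: lin_rec_def flip: add.assoc)

lemma lin_rec_zero:
  assumes "lin_rec R k c a"
  shows "lin_rec R k c (\<lambda>_. \<zero>)"
proof -
  have "(\<Oplus>i\<in>{..<k}. c i \<otimes> \<zero>) = (\<Oplus>i\<in>{..<k}. \<zero>)"
    using lin_rec_coeff_closed[OF assms] by (intro finsum_cong') auto
  then show ?thesis
    using lin_rec_coeff_closed[OF assms] lin_rec_coeff_Units[OF assms] by (simp add: lin_rec_def)
qed

lemma lin_rec_recurrence_split:
  assumes "lin_rec R k c a" and "0 < k"
  shows "a (n + k) = c 0 \<otimes> a n \<oplus> (\<Oplus>i\<in>{0<..<k}. c i \<otimes> a (n + i))"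
proof -
  have "{..<k} = insert 0 {0<..<k}" using \<open>0 < k\<close> by auto
  then show ?thesis
    unfolding lin_rec_recurrence[OF assms(1)]
    using lin_rec_closed[OF assms(1)] lin_rec_coeff_closed[OF assms(1)] \<open>0 < k\<close>
    by (simp add: Pi_iff)
qed

text \<open>This is where the unit \<open>c 0\<close> enters: the recurrence can be solved for its oldest term.\<close>

lemma lin_rec_newest_eq_iff_oldest_eq:
  assumes a: "lin_rec R k c a" and b: "lin_rec R k c b" and "0 < k"
    and inner: "\<And>i. i \<in> {0<..<k} \<Longrightarrow> a (n + i) = b (n + i)"
  shows "a (n + k) = b (n + k) \<longleftrightarrow> a n = b n"
proof -
  define inner_sum where "inner_sum = (\<Oplus>i\<in>{0<..<k}. c i \<otimes> b (n + i))"
  have closed: "a n \<in> carrier R" "b n \<in> carrier R" "inner_sum \<in> carrier R"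
    using a b
    by (auto simp: inner_sum_def lin_rec_closed lin_rec_coeff_closed intro!: finsum_closed)
  have c0: "c 0 \<in> Units R" using a by (rule lin_rec_coeff_Units)
  have "(\<Oplus>i\<in>{0<..<k}. c i \<otimes> a (n + i)) = inner_sum"
    unfolding inner_sum_def using inner lin_rec_closed[OF b] lin_rec_coeff_closed[OF b]
    by (intro finsum_cong') auto
  then have "a (n + k) = c 0 \<otimes> a n \<oplus> inner_sum" "b (n + k) = c 0 \<otimes> b n \<oplus> inner_sum"
    using lin_rec_recurrence_split[OF a \<open>0 < k\<close>] lin_rec_recurrence_split[OF b \<open>0 < k\<close>]
    by (simp_all add: inner_sum_def)
  then have "a (n + k) = b (n + k) \<longleftrightarrow> c 0 \<otimes> a n = c 0 \<otimes> b n"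
    using closed c0 by (simp add: Units_closed)
  also have "\<dots> \<longleftrightarrow> a n = b n" using c0 closed by (intro Units_l_cancel)
  finally show ?thesis .
qed

lemma lin_rec_window_Suc_eq_iff:
  assumes "lin_rec R k c a" and "lin_rec R k c b" and "0 < k"
  shows "window k a (Suc n) = window k b (Suc n) \<longleftrightarrow> window k a n = window k b n"
proof -
  have "window k a (Suc n) = window k b (Suc n) \<longleftrightarrow>
      (\<forall>i\<in>insert k {0<..<k}. a (n + i) = b (n + i))"
  proof -
    have "insert k {0<..<k} = Suc ` {..<k}"
      using \<open>0 < k\<close> by (auto simp: image_Suc_lessThan)
    then show ?thesis by (simp only: window_eq_iff) auto
  qed
  moreover have "window k a n = window k b n \<longleftrightarrow>
      (\<forall>i\<in>insert 0 {0<..<k}. a (n + i) = b (n + i))"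
  proof -
    have "insert 0 {0<..<k} = {..<k}" using \<open>0 < k\<close> by auto
    then show ?thesis by (simp only: window_eq_iff) auto
  qed
  ultimately show ?thesis using lin_rec_newest_eq_iff_oldest_eq[OF assms] by auto
qed

lemma lin_rec_eq_if_window_eq:
  assumes "lin_rec R k c a" and "lin_rec R k c b" and "0 < k" and "window k a n = window k b n"
  shows "a = b"
proof -
  have window_0: "window k a m = window k b m \<longleftrightarrow> window k a 0 = window k b 0" for m
    using lin_rec_window_Suc_eq_iff[OF assms(1-3)] by (induction m) auto
  then have "window k a m = window k b m" for m using assms(4) by blast
  then have "a (m + 0) = b (m + 0)" for m using \<open>0 < k\<close> unfolding window_eq_iff by blast
  then show ?thesis by auto
qed

lemma is_period_if_window_eq:
  assumes a: "lin_rec R k c a" and "0 < k" and "i < j" and "window k a i = window k a j"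
  shows "is_period a (j - i)"
proof -
  have "window k (\<lambda>n. a ((j - i) + n)) i = window k a i"
    using assms(3,4) by (simp add: window_eq_iff)
  then have "(\<lambda>n. a ((j - i) + n)) = a"
    using lin_rec_eq_if_window_eq[OF lin_rec_shift[OF a] a \<open>0 < k\<close>] by blast
  then have "a ((j - i) + n) = a n" for n by (rule fun_cong)
  then show ?thesis using \<open>i < j\<close> by (simp add: is_period_def add.commute)
qed

lemma two_le_card_carrier:
  assumes "finite (carrier R)" and "\<one> \<noteq> \<zero>"
  shows "2 \<le> card (carrier R)"
  using card_mono[of "carrier R" "{\<zero>, \<one>}"] assms by simp

lemma two_le_card_carrier_power:
  assumes "finite (carrier R)" and "\<one> \<noteq> \<zero>" and "0 < k"
  shows "2 \<le> card (carrier R) ^ k"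
  using two_le_card_carrier[OF assms(1,2)] self_le_power[of "card (carrier R)" k] \<open>0 < k\<close>
  by linarith

lemma lin_rec_ex_period:
  assumes a: "lin_rec R k c a" and "0 < k" and fin: "finite (carrier R)" and "\<one> \<noteq> \<zero>"
  shows "\<exists>m \<le> card (carrier R) ^ k - 1. is_period a m"
proof (cases "\<exists>n. window k a n = window k (\<lambda>_. \<zero>) n")
  case True
  then have "a = (\<lambda>_. \<zero>)"
    using lin_rec_eq_if_window_eq[OF a lin_rec_zero[OF a] \<open>0 < k\<close>] by blast
  then have "is_period a 1" by (simp add: is_period_def)
  then show ?thesis
    using two_le_card_carrier_power[OF fin \<open>\<one> \<noteq> \<zero>\<close> \<open>0 < k\<close>] by (intro exI[of _ 1]) auto
next
  case False
  let ?N = "card (carrier R) ^ k" and ?zero = "window k (\<lambda>_. \<zero>) 0"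
  let ?windows = "({..<k} \<rightarrow>\<^sub>E carrier R) - {?zero}"
  have "window k a n \<noteq> ?zero" for n using False by (simp add: window_eq_iff)
  moreover have "window k a n \<in> {..<k} \<rightarrow>\<^sub>E carrier R" for n
    using lin_rec_closed[OF a] by (auto simp: window_def)
  ultimately have "window k a ` {..<?N} \<subseteq> ?windows" by auto
  then have "card (window k a ` {..<?N}) \<le> card ?windows"
    using fin by (intro card_mono) (simp_all add: finite_PiE)
  also have "\<dots> = ?N - 1"
    by (subst card_Diff_singleton) (auto simp: window_def card_PiE)
  also have "\<dots> < card {..<?N}"
    using two_le_card_carrier_power[OF fin \<open>\<one> \<noteq> \<zero>\<close> \<open>0 < k\<close>] by simp
  finally have "\<not> inj_on (window k a) {..<?N}" by (rule pigeonhole)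
  then obtain i j where "i < j" "j < ?N" "window k a i = window k a j"
    unfolding inj_on_def by (metis lessThan_iff linorder_neqE_nat)
  then have "is_period a (j - i)" "j - i \<le> ?N - 1"
    using is_period_if_window_eq[OF a \<open>0 < k\<close>] by auto
  then show ?thesis by blast
qed

end

lemma (in ring_hom_ring) hom_Units:
  assumes "x \<in> Units R"
  shows "h x \<in> Units S"
proof -
  obtain y where "x \<in> carrier R" "y \<in> carrier R" "y \<otimes> x = \<one>" "x \<otimes> y = \<one>"
    using assms by (auto simp: Units_def)
  then have "h y \<otimes>\<^bsub>S\<^esub> h x = \<one>\<^bsub>S\<^esub>" "h x \<otimes>\<^bsub>S\<^esub> h y = \<one>\<^bsub>S\<^esub>"
    by (metis hom_mult hom_one)+
  then show ?thesis
    using \<open>x \<in> carrier R\<close> \<open>y \<in> carrier R\<close> by (auto simp: Units_def)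
qed

lemma (in ring_hom_ring) lin_rec_hom:
  assumes "lin_rec R k c a"
  shows "lin_rec S k (\<lambda>i. h (c i)) (\<lambda>n. h (a n))"
proof -
  note terms = lin_rec_closed[OF assms] and coeffs = lin_rec_coeff_closed[OF assms]
  have "h (a (n + k)) = finsum S (\<lambda>i. h (c i) \<otimes>\<^bsub>S\<^esub> h (a (n + i))) {..<k}" for n
  proof -
    have "h (a (n + k)) = finsum S (h \<circ> (\<lambda>i. c i \<otimes> a (n + i))) {..<k}"
      unfolding lin_rec_recurrence[OF assms] using terms coeffs by (intro hom_finsum) auto
    also have "\<dots> = finsum S (\<lambda>i. h (c i) \<otimes>\<^bsub>S\<^esub> h (a (n + i))) {..<k}"
      using terms coeffs by (intro S.finsum_cong') auto
    finally show ?thesis .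
  qed
  then show ?thesis
    using terms coeffs hom_Units[OF lin_rec_coeff_Units[OF assms]] by (simp add: lin_rec_def)
qed

definition has_max_period_lin_rec :: "('a, 'm) ring_scheme \<Rightarrow> nat \<Rightarrow> bool" where
  "has_max_period_lin_rec R k \<longleftrightarrow>
     (\<exists>c a. lin_rec R k c a \<and> least_period a = card (carrier R) ^ k - 1)"

lemma has_max_period_lin_rec_iso:
  assumes "ring R" and "ring S" and "R \<simeq> S" and "has_max_period_lin_rec R k"
  shows "has_max_period_lin_rec S k"
proof -
  obtain h where h: "h \<in> ring_iso R S" using \<open>R \<simeq> S\<close> by (auto simp: is_ring_iso_def)
  interpret ring_hom_ring R S h
    using assms(1,2) h by (intro ring_hom_ringI2) (simp_all add: ring_iso_def)
  obtain c a where max_period: "lin_rec R k c a" "least_period a = card (carrier R) ^ k - 1"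
    using assms(4) by (auto simp: has_max_period_lin_rec_def)
  have "inj_on h (carrier R)" using h by (simp add: ring_iso_def bij_betw_def)
  then have "least_period (\<lambda>n. h (a n)) = least_period a"
    using lin_rec_closed[OF max_period(1)]
    by (simp add: least_period_eq_Least is_period_comp_inj_on[of h "carrier R"])
  then show ?thesis
    using lin_rec_hom[OF max_period(1)] max_period(2) ring_iso_same_card[OF \<open>R \<simeq> S\<close>]
    unfolding has_max_period_lin_rec_def by metis
qed

section \<open>Direct products\<close>

lemma fst_ring_hom_RDirProd: "fst \<in> ring_hom (RDirProd R S) R"
  and snd_ring_hom_RDirProd: "snd \<in> ring_hom (RDirProd R S) S"
  by (auto simp: ring_hom_def RDirProd_def DirProd_def monoid.defs)

lemma diff_one_mult_diff_one_less:
  fixes x y :: nat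
  assumes "2 \<le> x" and "2 \<le> y"
  shows "(x - 1) * (y - 1) < x * y - 1"
proof -
  obtain u v where "x = u + 2" "y = v + 2" using assms by (metis add.commute le_Suc_ex)
  then show ?thesis by (simp add: algebra_simps)
qed

lemma not_has_max_period_lin_rec_RDirProd:
  assumes "ring R" "finite (carrier R)" "\<one>\<^bsub>R\<^esub> \<noteq> \<zero>\<^bsub>R\<^esub>"
    and "ring S" "finite (carrier S)" "\<one>\<^bsub>S\<^esub> \<noteq> \<zero>\<^bsub>S\<^esub>"
    and "0 < k"
  shows "\<not> has_max_period_lin_rec (RDirProd R S) k"
proof
  interpret R: ring R by fact
  interpret S: ring S by fact
  let ?x = "card (carrier R) ^ k" and ?y = "card (carrier S) ^ k"
  have ring: "ring (RDirProd R S)" using assms by (intro RDirProd_ring)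
  have fst_hom: "ring_hom_ring (RDirProd R S) R fst"
    and snd_hom: "ring_hom_ring (RDirProd R S) S snd"
    using assms ring fst_ring_hom_RDirProd snd_ring_hom_RDirProd by (intro ring_hom_ringI2; blast)+
  assume "has_max_period_lin_rec (RDirProd R S) k"
  then obtain c a where max_period: "lin_rec (RDirProd R S) k c a" "least_period a = ?x * ?y - 1"
    by (auto simp: has_max_period_lin_rec_def RDirProd_carrier card_cartesian_product
        power_mult_distrib)
  obtain l where fst_period: "l \<le> ?x - 1" "is_period (\<lambda>n. fst (a n)) l"
    using R.lin_rec_ex_period[OF ring_hom_ring.lin_rec_hom[OF fst_hom max_period(1)]] assms by blast
  obtain m where snd_period: "m \<le> ?y - 1" "is_period (\<lambda>n. snd (a n)) m"
    using S.lin_rec_ex_period[OF ring_hom_ring.lin_rec_hom[OF snd_hom max_period(1)]] assms by blast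
  have "least_period a \<le> l * m"
    using fst_period(2) snd_period(2) by (intro least_period_le is_period_Pair)
  also have "\<dots> \<le> (?x - 1) * (?y - 1)" using fst_period(1) snd_period(1) by (rule mult_le_mono)
  also have "\<dots> < ?x * ?y - 1"
    using assms R.two_le_card_carrier_power S.two_le_card_carrier_power
    by (intro diff_one_mult_diff_one_less)
  finally show False using max_period(2) by simp
qed

lemma RDirProd_list_Cons_iso: "RDirProd_list (R # Rs) \<simeq> RDirProd R (RDirProd_list Rs)"
  using RDirProd_list_iso2 by (auto simp: is_ring_iso_def)

lemma RDirProd_list_singleton_iso: "R \<simeq> RDirProd_list [R]"
  using RDirProd_list_iso3 by (auto simp: is_ring_iso_def)

lemma finite_RDirProd_list:
  "(\<And>R. R \<in> set Rs \<Longrightarrow> finite (carrier R)) \<Longrightarrow> finite (carrier (RDirProd_list Rs))"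
  by (induction Rs) (auto simp: RDirProd_list_carrier)

lemma ring_RDirProd_list:
  "(\<And>R. R \<in> set Rs \<Longrightarrow> ring R) \<Longrightarrow> ring (RDirProd_list Rs)"
  by (simp add: RDirProd_list_is_ring)

lemma one_neq_zero_RDirProd_list:
  "\<one>\<^bsub>R\<^esub> \<noteq> \<zero>\<^bsub>R\<^esub> \<Longrightarrow> \<one>\<^bsub>RDirProd_list (R # Rs)\<^esub> \<noteq> \<zero>\<^bsub>RDirProd_list (R # Rs)\<^esub>"
  by (simp add: RDirProd_list_one RDirProd_list_zero')

lemma not_has_max_period_lin_rec_RDirProd_list:
  assumes "\<And>R. R \<in> set Rs \<Longrightarrow> ring R \<and> finite (carrier R) \<and> \<one>\<^bsub>R\<^esub> \<noteq> \<zero>\<^bsub>R\<^esub>"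
    and "2 \<le> length Rs" and "0 < k"
  shows "\<not> has_max_period_lin_rec (RDirProd_list Rs) k"
proof -
  obtain R S Ts where Rs: "Rs = R # S # Ts"
    using \<open>2 \<le> length Rs\<close> by (auto simp: Suc_le_length_iff numeral_2_eq_2)
  let ?P = "RDirProd_list (S # Ts)"
  have R: "ring R" "finite (carrier R)" "\<one>\<^bsub>R\<^esub> \<noteq> \<zero>\<^bsub>R\<^esub>" using assms(1) by (auto simp: Rs)
  have P: "ring ?P" "finite (carrier ?P)" "\<one>\<^bsub>?P\<^esub> \<noteq> \<zero>\<^bsub>?P\<^esub>"
    using assms(1) unfolding Rs
    by (intro ring_RDirProd_list finite_RDirProd_list one_neq_zero_RDirProd_list; auto)+
  have "ring (RDirProd_list Rs)" using assms(1) by (intro ring_RDirProd_list) auto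
  moreover have "RDirProd_list Rs \<simeq> RDirProd R ?P" unfolding Rs by (rule RDirProd_list_Cons_iso)
  ultimately show ?thesis
    using has_max_period_lin_rec_iso RDirProd_ring[OF R(1) P(1)]
      not_has_max_period_lin_rec_RDirProd[OF R P \<open>0 < k\<close>] by blast
qed

section \<open>Powers of the characteristic\<close>

text \<open>In a domain this says that \<open>n\<close> is a positive power of the characteristic, and the
  characteristic is positive.\<close>

definition (in ring) char_power :: "nat \<Rightarrow> bool" where
  "char_power n \<longleftrightarrow> 1 < n \<and> (\<forall>p. Factorial_Ring.prime p \<and> p dvd n \<longrightarrow> add_pow R p \<one> = \<zero>)"

lemma (in ring) char_power_power:
  assumes "char_power n" and "0 < k"
  shows "char_power (n ^ k)"
  using assms prime_dvd_power[of _ n k] one_less_power[of n k] by (auto simp: char_power_def)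

lemma (in ring_hom_ring) hom_add_pow:
  "x \<in> carrier R \<Longrightarrow> h (add_pow R n x) = add_pow S (n::nat) (h x)"
  by (induction n) auto

lemma (in ring_hom_ring) char_power_hom: "R.char_power n \<Longrightarrow> S.char_power n"
  unfolding R.char_power_def S.char_power_def using hom_add_pow[OF R.one_closed]
  by (metis hom_one hom_zero)

lemma (in domain) char_power_card_carrier:
  assumes "finite (carrier R)"
  shows "char_power (card (carrier R))"
  unfolding char_power_def
proof (intro conjI allI impI)
  show "1 < card (carrier R)"
    using two_le_card_carrier[OF assms one_not_zero] by simp
next
  fix p assume p: "Factorial_Ring.prime p \<and> p dvd card (carrier R)"
  then obtain m where "order (add_monoid R) = p ^ 1 * m"
    by (auto simp: order_def elim: dvdE)
  then obtain H where H: "subgroup H (add_monoid R)" "card H = p"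
    using sylow_thm[OF _ a_group, of p 1 m] assms p by auto
  interpret H: group "add_monoid R\<lparr>carrier := H\<rparr>"
    using subgroup.subgroup_is_group[OF H(1) a_group] .
  have "\<not> H \<subseteq> {\<zero>}"
    using card_mono[of "{\<zero>}" H] H(2) p prime_gt_1_nat[of p] by auto
  then obtain x where x: "x \<in> H" "x \<noteq> \<zero>" by auto
  then have "x \<in> carrier R" using subgroup.subset[OF H(1)] by auto
  have "add_pow R p x = \<zero>"
    using H.pow_order_eq_1[of x] x H(2) by (simp add: order_def add_pow_def nat_pow_def)
  then have "add_pow R p \<one> \<otimes> x = \<zero>" using \<open>x \<in> carrier R\<close> add_pow_ldistr by simp
  then show "add_pow R p \<one> = \<zero>"
    using x \<open>x \<in> carrier R\<close> integral[of "add_pow R p \<one>" x] by auto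
qed

context cring
begin

definition binomial_term :: "'a \<Rightarrow> 'a \<Rightarrow> nat \<Rightarrow> nat \<Rightarrow> 'a" where
  "binomial_term x y n i = add_pow R (n choose i) (x [^] i \<otimes> y [^] (n - i))"

lemma binomial_term_closed [simp]:
  "x \<in> carrier R \<Longrightarrow> y \<in> carrier R \<Longrightarrow> binomial_term x y n i \<in> carrier R"
  by (simp add: binomial_term_def)

lemma binomial_term_Suc_Suc:
  assumes x: "x \<in> carrier R" and y: "y \<in> carrier R"
  shows "binomial_term x y (Suc n) (Suc i) =
    binomial_term x y n i \<otimes> x \<oplus> binomial_term x y n (Suc i) \<otimes> y"
proof -
  let ?z = "x [^] Suc i \<otimes> y [^] (n - i)"
  have "binomial_term x y n i \<otimes> x = add_pow R (n choose i) ?z"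
    unfolding binomial_term_def using x y by (simp add: add_pow_ldistr) (simp add: m_ac)
  moreover have "binomial_term x y n (Suc i) \<otimes> y = add_pow R (n choose Suc i) ?z"
  proof (cases "i < n")
    case True
    then have "y [^] (n - i) = y [^] (n - Suc i) \<otimes> y" by (metis Suc_diff_Suc nat_pow_Suc)
    then show ?thesis
      unfolding binomial_term_def using x y by (simp add: add_pow_ldistr m_assoc)
  qed (use y in \<open>simp add: binomial_term_def binomial_eq_0\<close>)
  ultimately show ?thesis
    using x y by (simp add: binomial_term_def add.nat_pow_mult)
qed

lemma binomial:
  assumes x: "x \<in> carrier R" and y: "y \<in> carrier R"
  shows "(x \<oplus> y) [^] n = (\<Oplus>i\<in>{..n}. binomial_term x y n i)"
proof (induction n)
  case 0
  show ?case by (simp add: binomial_term_def)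
next
  case (Suc n)
  let ?b = "binomial_term x y"
  have [simp]: "?b m i \<in> carrier R" for m i using x y by simp
  have last: "?b n (Suc n) = \<zero>" and first: "?b n 0 \<otimes> y = ?b (Suc n) 0"
    using y by (simp_all add: binomial_term_def binomial_eq_0)
  have "(x \<oplus> y) [^] Suc n = (\<Oplus>i\<in>{..n}. ?b n i) \<otimes> x \<oplus> (\<Oplus>i\<in>{..n}. ?b n i) \<otimes> y"
    using Suc x y by (simp add: r_distr)
  also have "(\<Oplus>i\<in>{..n}. ?b n i) \<otimes> y = (\<Oplus>i\<in>{..Suc n}. ?b n i) \<otimes> y"
    using y by (simp add: finsum_Suc last)
  also have "\<dots> = (\<Oplus>i\<in>{..n}. ?b n (Suc i) \<otimes> y) \<oplus> ?b (Suc n) 0"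
    using y by (subst finsum_Suc2) (simp_all add: l_distr finsum_ldistr first)
  also have "(\<Oplus>i\<in>{..n}. ?b n i) \<otimes> x \<oplus> \<dots> = (\<Oplus>i\<in>{..n}. ?b (Suc n) (Suc i)) \<oplus> ?b (Suc n) 0"
    using x y by (simp add: binomial_term_Suc_Suc finsum_addf finsum_ldistr a_assoc)
  also have "\<dots> = (\<Oplus>i\<in>{..Suc n}. ?b (Suc n) i)"
    by (subst finsum_Suc2) auto
  finally show ?case .
qed

lemma binomial_term_prime_eq_zero:
  assumes x: "x \<in> carrier R" and y: "y \<in> carrier R"
    and "Factorial_Ring.prime p" "add_pow R p \<one> = \<zero>" "0 < i" "i < p"
  shows "binomial_term x y p i = \<zero>"
proof -
  have "p dvd p choose i" using dvd_choose_prime[of i p] assms by auto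
  then obtain l where l: "p choose i = p * l" by (elim dvdE)
  define z where "z = add_pow R l (x [^] i \<otimes> y [^] (p - i))"
  have z: "z \<in> carrier R" using x y by (simp add: z_def)
  have "binomial_term x y p i = add_pow R p z"
    unfolding binomial_term_def z_def l using x y by (simp add: add.nat_pow_pow mult.commute)
  also have "\<dots> = add_pow R p \<one> \<otimes> z" using z by (simp add: add_pow_ldistr)
  finally show ?thesis using assms(4) z by simp
qed

lemma add_power_prime_char:
  assumes x: "x \<in> carrier R" and y: "y \<in> carrier R"
    and p: "Factorial_Ring.prime (p::nat)" "add_pow R p \<one> = \<zero>"
  shows "(x \<oplus> y) [^] p = x [^] p \<oplus> y [^] p"
proof -
  let ?b = "binomial_term x y p"
  obtain m where m: "p = Suc m" using prime_gt_0_nat[OF p(1)] gr0_implies_Suc by blast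
  have "(x \<oplus> y) [^] p = ?b p \<oplus> (\<Oplus>i\<in>{..m}. ?b i)"
    unfolding binomial[OF x y] using x y by (simp add: m finsum_Suc)
  also have "(\<Oplus>i\<in>{..m}. ?b i) = (\<Oplus>i\<in>{..m}. if 0 = i then ?b i else \<zero>)"
    using binomial_term_prime_eq_zero[OF x y p] x y by (intro finsum_cong') (auto simp: m)
  also have "\<dots> = ?b 0"
    using x y by (subst finsum_singleton) auto
  finally show ?thesis using x y by (simp add: binomial_term_def)
qed

lemma add_power_char_power:
  assumes "char_power n" and "x \<in> carrier R" and "y \<in> carrier R"
  shows "(x \<oplus> y) [^] n = x [^] n \<oplus> y [^] n"
  using assms
proof (induction n arbitrary: x y rule: less_induct)
  case (less n)
  then obtain p where p: "Factorial_Ring.prime p" "p dvd n" "add_pow R p \<one> = \<zero>"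
    using prime_factor_nat[of n] by (auto simp: char_power_def)
  then obtain m where m: "n = p * m" by (elim dvdE)
  have "(x \<oplus> y) [^] n = (x [^] p \<oplus> y [^] p) [^] m"
    using less.prems p by (simp add: m add_power_prime_char flip: nat_pow_pow)
  also have "\<dots> = (x [^] p) [^] m \<oplus> (y [^] p) [^] m"
  proof (cases "m = 1")
    case False
    moreover have "m \<noteq> 0" using less.prems(1) m by (intro notI) (simp add: char_power_def)
    ultimately have "1 < m" by simp
    then have "char_power m" using less.prems(1) m by (simp add: char_power_def)
    moreover have "m < n" using m prime_gt_1_nat[OF p(1)] \<open>1 < m\<close> by simp
    ultimately show ?thesis using less.prems by (intro less.IH) auto
  qed (use less.prems in simp)
  finally show ?case using less.prems by (simp add: m nat_pow_pow)
qed

end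

section \<open>Fixed points of power maps\<close>

definition (in ring) power_fixed_points :: "nat \<Rightarrow> 'a set" where
  "power_fixed_points n = {x \<in> carrier R. x [^] n = x}"

lemma (in field) subfield_power_fixed_points:
  assumes n: "char_power n"
  shows "subfield (power_fixed_points n) R"
proof (rule subfieldI'[OF subringI])
  show "power_fixed_points n \<subseteq> carrier R" "\<one> \<in> power_fixed_points n"
    by (auto simp: power_fixed_points_def)
next
  fix x assume x: "x \<in> power_fixed_points n"
  then have "x \<oplus> (\<ominus> x) [^] n = \<zero>"
    using add_power_char_power[OF n, of x "\<ominus> x"] n
    by (simp add: power_fixed_points_def char_power_def r_neg nat_pow_zero)
  then show "\<ominus> x \<in> power_fixed_points n"
    using x minus_equality[of "(\<ominus> x) [^] n" x] by (simp add: power_fixed_points_def a_comm)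
next
  fix x y assume "x \<in> power_fixed_points n" "y \<in> power_fixed_points n"
  then show "x \<otimes> y \<in> power_fixed_points n" "x \<oplus> y \<in> power_fixed_points n"
    using add_power_char_power[OF n] by (auto simp: power_fixed_points_def nat_pow_distrib)
next
  fix x assume "x \<in> power_fixed_points n - {\<zero>}"
  then have x: "x \<in> Units R" "x \<in> carrier R" "x [^] n = x"
    by (auto simp: power_fixed_points_def field_Units)
  then have "x \<otimes> (inv x) [^] n = \<one>"
    using nat_pow_distrib[of x "inv x" n] by simp
  then show "inv x \<in> power_fixed_points n"
    using x comm_inv_char[of x "(inv x) [^] n"] by (simp add: power_fixed_points_def)
qed

lemma (in field) power_card_carrier_eq:
  assumes "finite (carrier R)" and "x \<in> carrier R"
  shows "x [^] (card (carrier R) ^ k) = x"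
proof (induction k)
  case (Suc k)
  have "x [^] card (carrier R) = x"
  proof (cases "x = \<zero>")
    case True
    then show ?thesis
      using two_le_card_carrier[OF assms(1) one_not_zero] by (simp add: nat_pow_zero)
  next
    case False
    then have "x [^] card (carrier R - {\<zero>}) = \<one>"
      using units_power_order_eq_one[of x] assms by (simp add: field_Units)
    moreover have "card (carrier R) = Suc (card (carrier R - {\<zero>}))"
      using assms(1) by (metis card.remove zero_closed)
    ultimately show ?thesis using assms(2) by (metis l_one nat_pow_Suc)
  qed
  then show ?case
    using Suc assms(2) nat_pow_pow[of x "card (carrier R)" "card (carrier R) ^ k"] by simp
qed (use assms in simp)

context domain
begin

definition power_minus_var :: "nat \<Rightarrow> 'a list" where
  "power_minus_var n = X [^]\<^bsub>poly_ring R\<^esub> n \<ominus>\<^bsub>poly_ring R\<^esub> X"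

lemma power_minus_var_closed: "power_minus_var n \<in> carrier (poly_ring R)"
proof -
  interpret UP: domain "poly_ring R" using univ_poly_is_domain[OF carrier_is_subring] .
  show ?thesis by (simp add: power_minus_var_def var_closed[OF carrier_is_subring])
qed

lemma eval_power_minus_var:
  assumes "x \<in> carrier R"
  shows "eval (power_minus_var n) x = x [^] n \<ominus> x"
proof -
  interpret eval: ring_hom_ring "poly_ring R" R "\<lambda>p. eval p x"
    using eval_ring_hom[OF carrier_is_subring assms] .
  show ?thesis
    using assms var_closed(1)[OF carrier_is_subring]
    by (simp add: power_minus_var_def a_minus_def eval.hom_nat_pow eval_var)
qed

lemma degree_power_minus_var:
  assumes "1 < n"
  shows "degree (power_minus_var n) = n"
proof -
  interpret UP: domain "poly_ring R" using univ_poly_is_domain[OF carrier_is_subring] .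
  have X: "X \<in> carrier (poly_ring R)" using var_closed(1)[OF carrier_is_subring] .
  have "degree (X [^]\<^bsub>poly_ring R\<^esub> n) = n"
    using polynomial_pow_degree[OF X, of n] by (simp add: var_def)
  moreover have "degree (\<ominus>\<^bsub>poly_ring R\<^esub> X) = 1"
    using univ_poly_a_inv_degree[OF carrier_is_subring X] by (simp add: var_def)
  ultimately show ?thesis
    using poly_add_degree_eq[OF carrier_is_subring] X assms
    by (simp add: power_minus_var_def a_minus_def univ_poly_add univ_poly_carrier)
qed

text \<open>For a fixed point \<open>a\<close> additivity of the \<open>n\<close>-th power gives
  \<open>X\<^sup>n - X = Y\<^sup>n - Y = Y (Y\<^bsup>n-1\<^esup> - 1)\<close> with \<open>Y = X - a\<close>, and \<open>a\<close> is not a root of the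
  second factor.\<close>

lemma power_minus_var_factorization:
  assumes n: "char_power n" and a: "a \<in> power_fixed_points n"
  obtains u where "u \<in> carrier (poly_ring R)" and "eval u a \<noteq> \<zero>"
    and "power_minus_var n = [\<one>, \<ominus> a] \<otimes>\<^bsub>poly_ring R\<^esub> u"
proof -
  interpret UP: domain "poly_ring R" using univ_poly_is_domain[OF carrier_is_subring] .
  interpret const: ring_hom_ring R "poly_ring R" poly_of_const
    using canonical_embedding_ring_hom[OF carrier_is_subring] by simp
  have "a \<in> carrier R" using a by (simp add: power_fixed_points_def)
  interpret eval: ring_hom_ring "poly_ring R" R "\<lambda>p. eval p a"
    using eval_ring_hom[OF carrier_is_subring \<open>a \<in> carrier R\<close>] .
  obtain m where m: "n = Suc m" "0 < m" using n by (cases n) (auto simp: char_power_def)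
  define Y where "Y = [\<one>, \<ominus> a]"
  define C where "C = poly_of_const a"
  define u where "u = Y [^]\<^bsub>poly_ring R\<^esub> m \<ominus>\<^bsub>poly_ring R\<^esub> \<one>\<^bsub>poly_ring R\<^esub>"
  have Y: "Y \<in> carrier (poly_ring R)" "eval Y a = \<zero>"
    using \<open>a \<in> carrier R\<close> by (simp_all add: Y_def polynomial_def r_neg flip: univ_poly_carrier)
  have C: "C \<in> carrier (poly_ring R)" "C [^]\<^bsub>poly_ring R\<^esub> n = C"
    using a const.hom_nat_pow[of a n] by (simp_all add: C_def power_fixed_points_def)
  have X: "X = Y \<oplus>\<^bsub>poly_ring R\<^esub> C"
    using \<open>a \<in> carrier R\<close> by (simp add: var_def Y_def C_def poly_of_const_def univ_poly_add l_neg)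
  have Ym: "Y [^]\<^bsub>poly_ring R\<^esub> m \<in> carrier (poly_ring R)" using Y by simp
  have "power_minus_var n =
      (Y [^]\<^bsub>poly_ring R\<^esub> n \<oplus>\<^bsub>poly_ring R\<^esub> C) \<ominus>\<^bsub>poly_ring R\<^esub> (Y \<oplus>\<^bsub>poly_ring R\<^esub> C)"
    using UP.add_power_char_power[OF const.char_power_hom[OF n] Y(1) C(1)]
    by (simp add: power_minus_var_def X C(2))
  also have "\<dots> = Y \<otimes>\<^bsub>poly_ring R\<^esub> u"
    using Y(1) C(1) Ym UP.nat_pow_Suc2[OF Y(1), of m] unfolding u_def m(1) by algebra
  finally have "power_minus_var n = Y \<otimes>\<^bsub>poly_ring R\<^esub> u" .
  moreover have "u \<in> carrier (poly_ring R)" using Ym by (simp add: u_def)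
  moreover have "eval u a = \<ominus> \<one>"
    using Y Ym m(2) by (simp add: u_def a_minus_def eval.hom_nat_pow nat_pow_zero)
  ultimately show thesis using that by (simp add: Y_def)
qed

lemma alg_mult_power_minus_var:
  assumes n: "char_power n" and a: "a \<in> power_fixed_points n"
  shows "alg_mult (power_minus_var n) a \<le> 1"
proof (rule ccontr)
  interpret UP: domain "poly_ring R" using univ_poly_is_domain[OF carrier_is_subring] .
  let ?Y = "[\<one>, \<ominus> a]"
  have "a \<in> carrier R" using a by (simp add: power_fixed_points_def)
  then have Y: "?Y \<in> carrier (poly_ring R)" "?Y \<noteq> \<zero>\<^bsub>poly_ring R\<^esub>" "eval ?Y a = \<zero>"
    by (simp_all add: polynomial_def r_neg univ_poly_zero flip: univ_poly_carrier)
  obtain u where u: "u \<in> carrier (poly_ring R)" "eval u a \<noteq> \<zero>"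
    "power_minus_var n = ?Y \<otimes>\<^bsub>poly_ring R\<^esub> u"
    using power_minus_var_factorization[OF n a] .
  assume "\<not> alg_mult (power_minus_var n) a \<le> 1"
  then have "?Y [^]\<^bsub>poly_ring R\<^esub> (2::nat) pdivides power_minus_var n"
    using le_alg_mult_imp_pdivides[OF \<open>a \<in> carrier R\<close> power_minus_var_closed] by simp
  then obtain v where v: "v \<in> carrier (poly_ring R)"
    "power_minus_var n = ?Y \<otimes>\<^bsub>poly_ring R\<^esub> (?Y \<otimes>\<^bsub>poly_ring R\<^esub> v)"
    using Y(1) by (auto simp: pdivides_def factor_def numeral_2_eq_2 UP.m_assoc)
  then have "u = ?Y \<otimes>\<^bsub>poly_ring R\<^esub> v"
    using u Y UP.m_lcancel[of ?Y u "?Y \<otimes>\<^bsub>poly_ring R\<^esub> v"] by simp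
  then have "?Y pdivides u" using v(1) by (auto simp: pdivides_def factor_def)
  then show False
    using pdivides_imp_root_sharing[OF Y(1) _ \<open>a \<in> carrier R\<close>] Y(3) u(2) by blast
qed

end

lemma (in algebraically_closed) card_power_fixed_points:
  assumes n: "char_power n"
  shows "card (power_fixed_points n) = n"
proof -
  let ?p = "power_minus_var n"
  have poly: "?p \<in> carrier (poly_ring L)" "degree ?p = n"
    using n power_minus_var_closed degree_power_minus_var by (simp_all add: char_power_def)
  then have "?p \<noteq> []" using n by (auto simp: char_power_def)
  then have roots: "x \<in># roots ?p \<longleftrightarrow> x \<in> power_fixed_points n" for x
    by (auto simp: roots_mem_iff_is_root[OF poly(1)] is_root_def power_fixed_points_def
        eval_power_minus_var)
  have "count (roots ?p) x = 1" if "x \<in># roots ?p" for x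
    using that alg_mult_power_minus_var[OF n] roots alg_mult_eq_count_roots[OF poly(1)]
    by (metis One_nat_def Suc_leI count_greater_zero_iff le_antisym)
  then have "size (roots ?p) = card (set_mset (roots ?p))"
    by (simp add: size_multiset_overloaded_eq)
  also have "set_mset (roots ?p) = power_fixed_points n" using roots by auto
  finally show ?thesis using roots_over_carrier[OF poly(1)] poly(2) by (simp add: splitted_def)
qed

lemma (in field) exists_finite_extension:
  assumes fin: "finite (carrier R)" and "0 < k"
  obtains M :: "(('a list \<times> nat) multiset \<Rightarrow> 'a) ring" and h
  where "field M" and "h \<in> ring_hom R M" and "card (carrier M) = card (carrier R) ^ k"
proof -
  let ?q = "card (carrier R) ^ k"
  interpret L: algebraic_closure alg_closure "indexed_const ` carrier R" by (rule alg_closureE)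
  have h: "indexed_const \<in> ring_hom R alg_closure" by (rule alg_closureE)
  interpret h: ring_hom_ring R alg_closure indexed_const
    using h by (intro ring_hom_ringI2 ring_axioms L.ring_axioms)
  have char_power_q: "L.char_power ?q"
    using h.char_power_hom[OF char_power_power[OF char_power_card_carrier[OF fin] \<open>0 < k\<close>]] .
  let ?M = "alg_closure\<lparr>carrier := L.power_fixed_points ?q\<rparr>"
  have "field ?M" using L.subfield_iff(2)[OF L.subfield_power_fixed_points[OF char_power_q]] .
  moreover have "indexed_const x \<in> L.power_fixed_points ?q" if "x \<in> carrier R" for x
    using power_card_carrier_eq[OF fin that, of k] that
    by (simp add: L.power_fixed_points_def flip: h.hom_nat_pow)
  then have "indexed_const \<in> ring_hom R ?M"
    using h by (auto simp: ring_hom_def)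
  moreover have "card (carrier ?M) = ?q" using L.card_power_fixed_points[OF char_power_q] by simp
  ultimately show thesis using that by blast
qed

section \<open>Linear recurrences from algebraic elements\<close>

context ring
begin

lemma finsum_subring:
  assumes "subring K R" and "f \<in> A \<rightarrow> K"
  shows "finsum (R\<lparr>carrier := K\<rparr>) f A = finsum R f A"
proof -
  have "id \<in> ring_hom (R\<lparr>carrier := K\<rparr>) R"
    using subringE(1)[OF assms(1)] by (auto simp: ring_hom_def)
  then interpret ring_hom_ring "R\<lparr>carrier := K\<rparr>" R id
    using subring_is_ring[OF assms(1)] by (intro ring_hom_ringI2) (auto intro: ring_axioms)
  show ?thesis using hom_finsum[of f A] assms(2) by simp
qed

lemma finsum_mem_subring:
  assumes "subring K R" and "f \<in> A \<rightarrow> K"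
  shows "finsum R f A \<in> K"
proof -
  interpret K: ring "R\<lparr>carrier := K\<rparr>" using subring_is_ring[OF assms(1)] .
  show ?thesis using K.finsum_closed[of f A] assms by (simp add: finsum_subring)
qed

definition linear_functional :: "'a set \<Rightarrow> 'a set \<Rightarrow> ('a \<Rightarrow> 'a) \<Rightarrow> bool" where
  "linear_functional K E \<phi> \<longleftrightarrow> \<phi> \<in> E \<rightarrow> K \<and>
     (\<forall>x\<in>E. \<forall>y\<in>E. \<phi> (x \<oplus> y) = \<phi> x \<oplus> \<phi> y) \<and> (\<forall>c\<in>K. \<forall>x\<in>E. \<phi> (c \<otimes> x) = c \<otimes> \<phi> x)"

lemma linear_functional_closed: "linear_functional K E \<phi> \<Longrightarrow> x \<in> E \<Longrightarrow> \<phi> x \<in> K"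
  and linear_functional_add:
    "linear_functional K E \<phi> \<Longrightarrow> x \<in> E \<Longrightarrow> y \<in> E \<Longrightarrow> \<phi> (x \<oplus> y) = \<phi> x \<oplus> \<phi> y"
  and linear_functional_smult:
    "linear_functional K E \<phi> \<Longrightarrow> c \<in> K \<Longrightarrow> x \<in> E \<Longrightarrow> \<phi> (c \<otimes> x) = c \<otimes> \<phi> x"
  by (auto simp: linear_functional_def)

lemma linear_functional_zero:
  assumes "linear_functional K E \<phi>" and "subring K R" and "subring E R"
  shows "\<phi> \<zero> = \<zero>"
  using linear_functional_smult[OF assms(1), of \<zero> \<zero>] linear_functional_closed[OF assms(1), of \<zero>]
    subringE(1,2)[OF assms(2)] subringE(2)[OF assms(3)] by auto

lemma linear_functional_finsum:
  assumes \<phi>: "linear_functional K E \<phi>" and K: "subring K R" and E: "subring E R" and "K \<subseteq> E"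
    and "finite A" and "c \<in> A \<rightarrow> K" and "g \<in> A \<rightarrow> E"
  shows "\<phi> (\<Oplus>i\<in>A. c i \<otimes> g i) = (\<Oplus>i\<in>A. c i \<otimes> \<phi> (g i))"
  using assms(5-)
proof (induction A rule: finite_induct)
  case empty
  show ?case using linear_functional_zero[OF \<phi> K E] by simp
next
  case (insert j A)
  have c_mem: "c i \<in> K" and g_mem: "g i \<in> E" and \<phi>g_mem: "\<phi> (g i) \<in> K" if "i \<in> insert j A" for i
    using insert.prems that linear_functional_closed[OF \<phi>] by auto
  have cg_mem: "c i \<otimes> g i \<in> E" and c\<phi>g_mem: "c i \<otimes> \<phi> (g i) \<in> K" if "i \<in> insert j A" for i
    using c_mem[OF that] g_mem[OF that] \<phi>g_mem[OF that] \<open>K \<subseteq> E\<close>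
      subringE(6)[OF E] subringE(6)[OF K] by blast+
  have sum_mem: "(\<Oplus>i\<in>A. c i \<otimes> g i) \<in> E" using cg_mem by (intro finsum_mem_subring[OF E]) auto
  have "\<phi> (\<Oplus>i\<in>insert j A. c i \<otimes> g i) = \<phi> (c j \<otimes> g j \<oplus> (\<Oplus>i\<in>A. c i \<otimes> g i))"
    using insert.hyps cg_mem subringE(1)[OF E] by (subst finsum_insert) auto
  also have "\<dots> = c j \<otimes> \<phi> (g j) \<oplus> (\<Oplus>i\<in>A. c i \<otimes> \<phi> (g i))"
    using sum_mem cg_mem c_mem g_mem insert
    by (simp add: linear_functional_add[OF \<phi>] linear_functional_smult[OF \<phi>])
  also have "\<dots> = (\<Oplus>i\<in>insert j A. c i \<otimes> \<phi> (g i))"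
    using insert.hyps c\<phi>g_mem subringE(1)[OF K] by (subst finsum_insert) auto
  finally show ?case .
qed

lemma inj_on_combine:
  assumes K: "subfield K R" and independent: "independent K Us"
  shows "inj_on (\<lambda>Ks. combine Ks Us) {Ks. set Ks \<subseteq> K \<and> length Ks = length Us}"
proof (rule inj_onI)
  fix Ks Ls
  assume coords: "Ks \<in> {Ks. set Ks \<subseteq> K \<and> length Ks = length Us}"
    "Ls \<in> {Ks. set Ks \<subseteq> K \<and> length Ks = length Us}" "combine Ks Us = combine Ls Us"
  then have "combine Ks Us \<in> Span K Us"
    using Span_mem_iff_length_version[OF K independent_in_carrier[OF independent]] by auto
  from unique_decomposition[OF K independent this] obtain Js where
    "\<And>Ls. set Ls \<subseteq> K \<Longrightarrow> length Ls = length Us \<Longrightarrow> combine Ks Us = combine Ls Us \<Longrightarrow> Ls = Js"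
    by (elim ex1E) blast
  from this[of Ks] this[of Ls] show "Ks = Ls" using coords by simp
qed

definition hd_coordinate :: "'a set \<Rightarrow> 'a list \<Rightarrow> 'a \<Rightarrow> 'a" where
  "hd_coordinate K Us x =
     hd (inv_into {Ks. set Ks \<subseteq> K \<and> length Ks = length Us} (\<lambda>Ks. combine Ks Us) x)"

lemma hd_coordinate_combine:
  assumes "subfield K R" and "independent K Us" and "set Ks \<subseteq> K" and "length Ks = length Us"
  shows "hd_coordinate K Us (combine Ks Us) = hd Ks"
  using inv_into_f_f[OF inj_on_combine[OF assms(1,2)], of Ks] assms(3,4)
  by (simp add: hd_coordinate_def)

lemma linear_functional_hd_coordinate:
  assumes K: "subfield K R" and independent: "independent K Us" and "Us \<noteq> []"
  shows "linear_functional K (Span K Us) (hd_coordinate K Us)"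
proof -
  note K_closed = subringE[OF subfieldE(1)[OF K]]
  note Us_carrier = independent_in_carrier[OF independent]
  note coordinate = hd_coordinate_combine[OF K independent]
  note coords = Span_mem_iff_length_version[OF K Us_carrier, THEN iffD1]
  show ?thesis
    unfolding linear_functional_def
  proof (intro conjI ballI funcsetI)
    fix x assume "x \<in> Span K Us"
    then obtain Ks where Ks: "set Ks \<subseteq> K" "length Ks = length Us" "x = combine Ks Us"
      using coords by blast
    then have "Ks \<noteq> []" using \<open>Us \<noteq> []\<close> by auto
    then show "hd_coordinate K Us x \<in> K" using Ks hd_in_set by (auto simp: coordinate)
    {
      fix y assume "y \<in> Span K Us"
      then obtain Ls where Ls: "set Ls \<subseteq> K" "length Ls = length Us" "y = combine Ls Us"
        using coords by blast
      then have "x \<oplus> y = combine (map2 (\<oplus>) Ks Ls) Us"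
        using Ks Us_carrier K_closed(1) combine_add[of Ks Us Ls] by auto
      moreover have "set (map2 (\<oplus>) Ks Ls) \<subseteq> K"
        using Ks Ls by (auto elim!: in_set_zipE intro!: K_closed(7))
      moreover have "Ls \<noteq> []" using Ls \<open>Us \<noteq> []\<close> by auto
      ultimately show "hd_coordinate K Us (x \<oplus> y) = hd_coordinate K Us x \<oplus> hd_coordinate K Us y"
        using Ks Ls \<open>Ks \<noteq> []\<close> by (simp add: coordinate hd_map hd_zip)
    }
    fix k assume "k \<in> K"
    then have "k \<otimes> x = combine (map ((\<otimes>) k) Ks) Us"
      using Ks Us_carrier K_closed(1) combine_r_distr[of Ks Us k] by auto
    moreover have "set (map ((\<otimes>) k) Ks) \<subseteq> K" using Ks \<open>k \<in> K\<close> K_closed(6) by auto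
    ultimately show "hd_coordinate K Us (k \<otimes> x) = k \<otimes> hd_coordinate K Us x"
      using Ks \<open>Ks \<noteq> []\<close> by (simp add: coordinate hd_map)
  qed
qed

lemma hd_coordinate_hd:
  assumes K: "subfield K R" and independent: "independent K (u # Us)"
  shows "hd_coordinate K (u # Us) u = \<one>"
proof -
  let ?Ks = "\<one> # replicate (length Us) \<zero>"
  have "set ?Ks \<subseteq> K" using subringE(2,3)[OF subfieldE(1)[OF K]] by auto
  then have "hd_coordinate K (u # Us) (combine ?Ks (u # Us)) = \<one>"
    using hd_coordinate_combine[OF K independent, of ?Ks] by simp
  moreover have "combine ?Ks (u # Us) = u"
    using independent_in_carrier[OF independent] by (simp add: combine_replicate)
  ultimately show ?thesis by simp
qed

lemma eval_eq_finsum: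
  assumes "set p \<subseteq> carrier R" and "x \<in> carrier R"
  shows "eval p x = (\<Oplus>i\<in>{..<length p}. coeff p i \<otimes> x [^] i)"
  using assms(1)
proof (induction p)
  case (Cons a p)
  have "(\<Oplus>i\<in>{..<length p}. coeff (a # p) i \<otimes> x [^] i) = (\<Oplus>i\<in>{..<length p}. coeff p i \<otimes> x [^] i)"
    using Cons.prems assms(2) by (intro finsum_cong') auto
  then show ?case
    using Cons assms(2) by (simp add: lessThan_Suc Pi_iff)
qed simp

end

lemma (in cring) const_term_eq_coeff_0: "set p \<subseteq> carrier R \<Longrightarrow> const_term p = coeff p 0"
  unfolding const_term_def by (induction p) (auto simp: nat_pow_zero)

lemma (in cring) power_eq_finsum_if_monic_root:
  assumes p: "set p \<subseteq> carrier R" "p \<noteq> []" "lead_coeff p = \<one>" and x: "x \<in> carrier R" "eval p x = \<zero>"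
  shows "x [^] (n + degree p) = (\<Oplus>i\<in>{..<degree p}. \<ominus> coeff p i \<otimes> x [^] (n + i))"
proof -
  obtain q where q: "p = \<one> # q" using p(2,3) by (cases p) auto
  then have coeff: "coeff p i = coeff q i" if "i < length q" for i using that by simp
  have "set q \<subseteq> carrier R" using p(1) q by auto
  then have "eval q x \<in> carrier R" using x(1) by (rule eval_in_carrier)
  then have "x [^] length q = \<ominus> eval q x"
    using x minus_equality[of "x [^] length q" "eval q x"] by (simp add: q)
  then have "x [^] (n + length q) = \<ominus> (x [^] n) \<otimes> eval q x"
    using x(1) \<open>eval q x \<in> carrier R\<close> by (simp add: l_minus r_minus flip: nat_pow_mult)
  also have "\<dots> = (\<Oplus>i\<in>{..<length q}. \<ominus> (x [^] n) \<otimes> (coeff q i \<otimes> x [^] i))"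
    unfolding eval_eq_finsum[OF \<open>set q \<subseteq> carrier R\<close> x(1)]
    using x(1) \<open>set q \<subseteq> carrier R\<close> by (intro finsum_rdistr) auto
  also have "\<dots> = (\<Oplus>i\<in>{..<length q}. \<ominus> coeff p i \<otimes> x [^] (n + i))"
    using x(1) \<open>set q \<subseteq> carrier R\<close> coeff
    by (intro finsum_cong') (auto simp: l_minus r_minus m_lcomm simp flip: nat_pow_mult)
  finally show ?thesis by (simp add: q)
qed

lemma (in domain) power_mem_simple_extension:
  assumes "subring K R" and "x \<in> carrier R"
  shows "x [^] (n::nat) \<in> simple_extension K x"
  using simple_extension_mem[OF assms] subringE(3,6)[OF simple_extension_is_subring[OF assms]]
  by (induction n) auto

context field
begin

context
  fixes K \<alpha>
  assumes K: "subfield K R" and \<alpha>: "\<alpha> \<in> carrier R" "(algebraic over K) \<alpha>" and \<alpha>_nonzero: "\<alpha> \<noteq> \<zero>"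
begin

interpretation E: subfield "simple_extension K \<alpha>" R
  using simple_extension_is_subfield[OF K \<alpha>(1)] \<alpha>(2) by simp

lemma coeff_0_Irr_nonzero: "coeff (Irr K \<alpha>) 0 \<noteq> \<zero>"
proof
  note Irr = IrrE[OF K \<alpha>]
  assume "coeff (Irr K \<alpha>) 0 = \<zero>"
  moreover have "set (Irr K \<alpha>) \<subseteq> carrier R"
    using Irr(1) subfieldE(3)[OF K] by (auto simp: polynomial_def simp flip: univ_poly_carrier)
  ultimately have "eval (Irr K \<alpha>) \<zero> = \<zero>"
    using const_term_eq_coeff_0 by (simp add: const_term_def)
  moreover have "X \<in> carrier (K[X])" "pirreducible K X" "eval X \<zero> = \<zero>" "lead_coeff X = \<one>"
    using var_closed(1)[OF subfieldE(1)[OF K]] degree_one_imp_pirreducible[OF K, of X]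
    by (simp_all add: var_def)
  ultimately have "Irr K \<alpha> = X"
    using minimal_polynomial_is_unique[OF K zero_closed] Irr
      zero_is_algebraic[OF subfieldE(1)[OF K]]
    by (auto simp: over_def)
  then show False using Irr(4) \<alpha>(1) \<alpha>_nonzero by (simp add: eval_var)
qed

lemma lin_rec_linear_functional_powers:
  assumes \<phi>: "linear_functional K (simple_extension K \<alpha>) \<phi>"
  shows "lin_rec (R\<lparr>carrier := K\<rparr>) (degree (Irr K \<alpha>)) (\<lambda>i. \<ominus> coeff (Irr K \<alpha>) i)
    (\<lambda>n. \<phi> (\<alpha> [^] n))"
    (is "lin_rec _ ?d ?c ?a")
proof -
  note Irr = IrrE[OF K \<alpha>] and K_ring = subfieldE(1)[OF K]
  note powers_mem = power_mem_simple_extension[OF K_ring \<alpha>(1)]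
  have Irr_K: "set (Irr K \<alpha>) \<subseteq> K" and Irr_nonempty: "Irr K \<alpha> \<noteq> []"
    using Irr(1) pirreducibleE(1)[OF K_ring Irr(1,2)]
    by (auto simp: polynomial_def simp flip: univ_poly_carrier)
  then have Irr_R: "set (Irr K \<alpha>) \<subseteq> carrier R" using subfieldE(3)[OF K] by blast
  have "range (coeff (Irr K \<alpha>)) \<subseteq> K"
    unfolding coeff_img(3) using Irr_K subringE(2)[OF K_ring] by simp
  then have coeffs: "?c i \<in> K" for i by (intro subringE(5)[OF K_ring]) auto
  have terms: "?a n \<in> K" for n using linear_functional_closed[OF \<phi> powers_mem] .
  have "?c 0 \<noteq> \<zero>" using coeff_0_Irr_nonzero Irr_R by simp
  then have "?c 0 \<in> Units (R\<lparr>carrier := K\<rparr>)" using subfield.subfield_Units[OF K] coeffs by simp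
  moreover have "?a (n + ?d) = finsum (R\<lparr>carrier := K\<rparr>) (\<lambda>i. ?c i \<otimes> ?a (n + i)) {..<?d}" for n
  proof -
    have "?a (n + ?d) = \<phi> (\<Oplus>i\<in>{..<?d}. ?c i \<otimes> \<alpha> [^] (n + i))"
      using power_eq_finsum_if_monic_root[OF Irr_R Irr_nonempty Irr(3) \<alpha>(1) Irr(4)] by simp
    also have "\<dots> = (\<Oplus>i\<in>{..<?d}. ?c i \<otimes> ?a (n + i))"
      using coeffs powers_mem simple_extension_incl[OF subfieldE(3)[OF K] \<alpha>(1)]
      by (intro linear_functional_finsum[OF \<phi> K_ring E.subring_axioms]) auto
    also have "\<dots> = finsum (R\<lparr>carrier := K\<rparr>) (\<lambda>i. ?c i \<otimes> ?a (n + i)) {..<?d}"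
      using terms coeffs subringE(6)[OF K_ring] by (intro finsum_subring[OF K_ring, symmetric]) auto
    finally show ?thesis .
  qed
  ultimately show ?thesis using terms coeffs by (simp add: lin_rec_def)
qed

lemma linear_functional_mult_eq_zero:
  assumes \<phi>: "linear_functional K (simple_extension K \<alpha>) \<phi>"
    and "y \<in> simple_extension K \<alpha>" and "\<beta> \<in> simple_extension K \<alpha>"
    and "\<And>n::nat. \<phi> (\<alpha> [^] n \<otimes> \<beta>) = \<zero>"
  shows "\<phi> (y \<otimes> \<beta>) = \<zero>"
  using assms(2-)
proof (induction y arbitrary: \<beta> rule: simple_extension.induct)
  case zero
  have "\<beta> \<in> carrier R" using zero.prems(1) subringE(1)[OF E.subring_axioms] by blast
  then show ?case using linear_functional_zero[OF \<phi> subfieldE(1)[OF K] E.subring_axioms] by simp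
next
  case (lin y c)
  note E_closed = subringE[OF E.subring_axioms]
  note \<alpha>_mem = simple_extension_mem[OF subfieldE(1)[OF K] \<alpha>(1)]
  have carrier: "c \<in> carrier R" "y \<in> carrier R" "\<beta> \<in> carrier R"
    using lin.hyps lin.prems(1) subfieldE(3)[OF K] E_closed(1) by blast+
  have "\<phi> (\<alpha> [^] n \<otimes> (\<alpha> \<otimes> \<beta>)) = \<zero>" for n :: nat
    using lin.prems(2)[of "Suc n"] carrier(3) \<alpha>(1) by (simp add: m_assoc)
  then have "\<phi> (y \<otimes> (\<alpha> \<otimes> \<beta>)) = \<zero>"
    using E_closed(6)[OF \<alpha>_mem lin.prems(1)] by (rule lin.IH[rotated])
  moreover have "\<phi> (c \<otimes> \<beta>) = \<zero>"
    using linear_functional_smult[OF \<phi> lin.hyps(2) lin.prems(1)] lin.prems(2)[of 0] carrier by simp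
  moreover have "(y \<otimes> \<alpha> \<oplus> c) \<otimes> \<beta> = c \<otimes> \<beta> \<oplus> y \<otimes> (\<alpha> \<otimes> \<beta>)"
    using carrier \<alpha>(1) by (simp add: l_distr m_assoc a_comm)
  moreover have "c \<otimes> \<beta> \<in> simple_extension K \<alpha>" "y \<otimes> (\<alpha> \<otimes> \<beta>) \<in> simple_extension K \<alpha>"
    using E_closed(6) \<alpha>_mem lin.hyps lin.prems(1) simple_extension_incl[OF subfieldE(3)[OF K] \<alpha>(1)]
    by blast+
  ultimately show ?case using linear_functional_add[OF \<phi>] by simp
qed

lemma linear_functional_eq_zero:
  assumes \<phi>: "linear_functional K (simple_extension K \<alpha>) \<phi>"
    and \<beta>: "\<beta> \<in> simple_extension K \<alpha>" "\<beta> \<noteq> \<zero>" "\<And>n::nat. \<phi> (\<alpha> [^] n \<otimes> \<beta>) = \<zero>"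
    and z: "z \<in> simple_extension K \<alpha>"
  shows "\<phi> z = \<zero>"
proof -
  note E_closed = subringE[OF E.subring_axioms]
  have inv: "inv \<beta> \<in> simple_extension K \<alpha>" "inv \<beta> \<otimes> \<beta> = \<one>"
    using \<beta>(1,2) subfield_m_inv(1,3)[OF E.subfield_axioms, of \<beta>] by auto
  have "z \<in> carrier R" "inv \<beta> \<in> carrier R" "\<beta> \<in> carrier R"
    using z inv(1) \<beta>(1) E_closed(1) by blast+
  then have "z \<otimes> inv \<beta> \<otimes> \<beta> = z" using inv(2) by (simp add: m_assoc)
  then show ?thesis
    using linear_functional_mult_eq_zero[OF \<phi> E_closed(6)[OF z inv(1)] \<beta>(1,3)] by simp
qed

lemma is_period_linear_functional_powers_iff:
  assumes \<phi>: "linear_functional K (simple_extension K \<alpha>) \<phi>"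
    and z: "z \<in> simple_extension K \<alpha>" "\<phi> z \<noteq> \<zero>"
  shows "is_period (\<lambda>n. \<phi> (\<alpha> [^] n)) m \<longleftrightarrow> 0 < m \<and> \<alpha> [^] m = \<one>"
proof
  assume "0 < m \<and> \<alpha> [^] m = \<one>"
  then show "is_period (\<lambda>n. \<phi> (\<alpha> [^] n)) m"
    using nat_pow_mult[OF \<alpha>(1), of _ m] nat_pow_closed[OF \<alpha>(1)] by (metis is_period_def r_one)
next
  assume period: "is_period (\<lambda>n. \<phi> (\<alpha> [^] n)) m"
  define \<beta> where "\<beta> = \<alpha> [^] m \<ominus> \<one>"
  note E_closed = subringE[OF E.subring_axioms]
  note powers_mem = power_mem_simple_extension[OF subfieldE(1)[OF K] \<alpha>(1)]
  have \<beta>: "\<beta> \<in> simple_extension K \<alpha>"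
    using E_closed(3,5,7) powers_mem by (simp add: \<beta>_def a_minus_def)
  have \<phi>_carrier: "\<phi> x \<in> carrier R" if "x \<in> simple_extension K \<alpha>" for x
    using linear_functional_closed[OF \<phi> that] subfieldE(3)[OF K] by blast
  have "\<phi> (\<alpha> [^] n \<otimes> \<beta>) = \<zero>" for n :: nat
  proof -
    have power_\<beta>: "\<alpha> [^] n \<otimes> \<beta> \<in> simple_extension K \<alpha>"
      using E_closed(6) powers_mem \<beta> by simp
    have "\<alpha> [^] (n + m) = \<alpha> [^] n \<otimes> \<beta> \<oplus> \<alpha> [^] n"
      using \<alpha>(1) nat_pow_mult[OF \<alpha>(1), of n m]
      by (simp add: \<beta>_def a_minus_def r_distr r_minus a_assoc l_neg)
    then have "\<phi> (\<alpha> [^] n) = \<phi> (\<alpha> [^] n \<otimes> \<beta>) \<oplus> \<phi> (\<alpha> [^] n)"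
      using period linear_functional_add[OF \<phi> power_\<beta> powers_mem, of n]
      unfolding is_period_def by metis
    then show ?thesis
      using \<phi>_carrier[OF power_\<beta>] \<phi>_carrier[OF powers_mem] by (metis add.r_cancel_one')
  qed
  then have "\<beta> = \<zero>" using linear_functional_eq_zero[OF \<phi> \<beta> _ _ z(1)] z(2) by blast
  then show "0 < m \<and> \<alpha> [^] m = \<one>"
    using period \<alpha>(1) by (simp add: is_period_def \<beta>_def)
qed

lemma exists_lin_rec_of_algebraic:
  "\<exists>c a. lin_rec (R\<lparr>carrier := K\<rparr>) (degree (Irr K \<alpha>)) c a \<and>
     (\<forall>m. is_period a m \<longleftrightarrow> 0 < m \<and> \<alpha> [^] m = \<one>)"
proof -
  obtain d where d: "degree (Irr K \<alpha>) = Suc d"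
    using pirreducible_degree[OF K IrrE(1,2)[OF K \<alpha>]] by (cases "degree (Irr K \<alpha>)") auto
  let ?base = "\<alpha> [^] d # exp_base \<alpha> d"
  have "exp_base \<alpha> (degree (Irr K \<alpha>)) = ?base" unfolding d exp_base_def by simp
  then have independent: "independent K ?base" and span: "Span K ?base = simple_extension K \<alpha>"
    using exp_base_independent[OF K \<alpha>] Span_exp_base[OF K \<alpha>] by metis+
  define \<phi> where "\<phi> = hd_coordinate K ?base"
  have \<phi>: "linear_functional K (simple_extension K \<alpha>) \<phi>"
    unfolding \<phi>_def span[symmetric] by (intro linear_functional_hd_coordinate K independent) simp
  moreover have "\<phi> (\<alpha> [^] d) \<noteq> \<zero>"
    using hd_coordinate_hd[OF K independent] by (simp add: \<phi>_def)
  ultimately show ?thesis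
    using lin_rec_linear_functional_powers
      is_period_linear_functional_powers_iff power_mem_simple_extension[OF subfieldE(1)[OF K] \<alpha>(1)]
    by blast
qed

end

section \<open>Sequences of maximal period over finite fields\<close>

lemma card_eq_card_power_dimension:
  assumes K: "subfield K R" and "finite K" and "dimension n K E"
  shows "card E = card K ^ n"
proof -
  obtain Us where Us: "set Us \<subseteq> carrier R" "independent K Us" "length Us = n" "Span K Us = E"
    using exists_base[OF K assms(3)] by blast
  let ?coords = "{Ks. set Ks \<subseteq> K \<and> length Ks = length Us}"
  have "E = (\<lambda>Ks. combine Ks Us) ` ?coords"
    using Span_eq_combine_set_length_version[OF K Us(1)] Us(4) by auto
  then have "card E = card ?coords" by (simp add: card_image[OF inj_on_combine[OF K Us(2)]])
  then show ?thesis using card_lists_length_eq[OF \<open>finite K\<close>] Us(3) by simp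
qed

lemma exists_primitive_element:
  assumes fin: "finite (carrier R)"
  obtains \<alpha> where "\<alpha> \<in> carrier R" and "\<alpha> \<noteq> \<zero>"
    and "carrier R - {\<zero>} = range (\<lambda>i::nat. \<alpha> [^] i)"
    and "\<And>m::nat. \<alpha> [^] m = \<one> \<longleftrightarrow> card (carrier R) - 1 dvd m"
proof -
  let ?G = "Multiplicative_Group.mult_of R"
  note mult_of = Multiplicative_Group.mult_of_simps
  interpret G: group ?G by (rule field_mult_group)
  obtain \<alpha> where \<alpha>: "\<alpha> \<in> carrier R" "\<alpha> \<noteq> \<zero>" "carrier R - {\<zero>} = {\<alpha> [^] i |i::nat. i \<in> UNIV}"
    using finite_field_mult_group_has_gen[OF fin] by (auto simp: mult_of)
  have "generate ?G {\<alpha>} = carrier R - {\<zero>}"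
    unfolding \<alpha>(3) using G.generate_pow_on_finite_carrier[of \<alpha>] fin \<alpha>(1,2) by (simp add: mult_of)
  then have "G.ord \<alpha> = card (carrier R) - 1"
    using G.generate_pow_card[of \<alpha>] \<alpha>(1,2) by (simp add: mult_of card_Diff_singleton)
  then have "\<alpha> [^] m = \<one> \<longleftrightarrow> card (carrier R) - 1 dvd m" for m :: nat
    using G.pow_eq_id[of \<alpha> m] \<alpha>(1,2) by (simp add: mult_of)
  with \<alpha> show thesis using that by (simp add: full_SetCompr_eq)
qed

lemma simple_extension_primitive_element:
  assumes "subring K R" and "\<alpha> \<in> carrier R" and "carrier R - {\<zero>} = range (\<lambda>i::nat. \<alpha> [^] i)"
  shows "simple_extension K \<alpha> = carrier R"
proof
  note extension_closed = subringE[OF simple_extension_is_subring[OF assms(1,2)]]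
  show "simple_extension K \<alpha> \<subseteq> carrier R" by (rule extension_closed(1))
  have "carrier R - {\<zero>} \<subseteq> simple_extension K \<alpha>"
    unfolding assms(3) using power_mem_simple_extension[OF assms(1,2)] by auto
  then show "carrier R \<subseteq> simple_extension K \<alpha>" by auto
qed

lemma has_max_period_lin_rec_subfield:
  assumes fin: "finite (carrier R)" and K: "subfield K R" and card: "card (carrier R) = card K ^ k"
  shows "has_max_period_lin_rec (R\<lparr>carrier := K\<rparr>) k"
proof -
  let ?N = "card (carrier R) - 1"
  obtain \<alpha> where \<alpha>: "\<alpha> \<in> carrier R" "\<alpha> \<noteq> \<zero>" "carrier R - {\<zero>} = range (\<lambda>i::nat. \<alpha> [^] i)"
    and order: "\<And>m::nat. \<alpha> [^] m = \<one> \<longleftrightarrow> ?N dvd m"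
    using exists_primitive_element[OF fin] by metis
  note K_ring = subfieldE(1)[OF K]
  have extension: "simple_extension K \<alpha> = carrier R"
    using simple_extension_primitive_element[OF K_ring \<alpha>(1,3)] .
  then have alg: "(algebraic over K) \<alpha>"
    using simple_extension_is_subfield[OF K \<alpha>(1)] carrier_is_subfield by simp
  have "finite K" using fin subfieldE(3)[OF K] by (rule finite_subset[rotated])
  have "{\<zero>, \<one>} \<subseteq> K" using subringE(2,3)[OF K_ring] by simp
  then have "1 < card K" using card_mono[OF \<open>finite K\<close>, of "{\<zero>, \<one>}"] by simp
  moreover have "card K ^ degree (Irr K \<alpha>) = card K ^ k"
    using card_eq_card_power_dimension[OF K \<open>finite K\<close> dimension_simple_extension[OF K \<alpha>(1) alg]]
      extension card by simp
  ultimately have "degree (Irr K \<alpha>) = k" by simp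
  then obtain c a where lin_rec: "lin_rec (R\<lparr>carrier := K\<rparr>) k c a"
    "\<And>m. is_period a m \<longleftrightarrow> 0 < m \<and> ?N dvd m"
    using exists_lin_rec_of_algebraic[OF K \<alpha>(1) alg \<alpha>(2)] order by metis
  have "least_period a = ?N"
    unfolding least_period_eq_Least lin_rec(2) using two_le_card_carrier[OF fin one_not_zero]
    by (intro Least_equality) (auto dest: dvd_imp_le)
  then show ?thesis using lin_rec(1) card by (auto simp: has_max_period_lin_rec_def)
qed

end

lemma (in field) has_max_period_lin_rec_finite_field:
  assumes fin: "finite (carrier R)" and "0 < k"
  shows "has_max_period_lin_rec R k"
proof -
  obtain M :: "(('a list \<times> nat) multiset \<Rightarrow> 'a) ring" and h
    where "field M" and h: "h \<in> ring_hom R M" and card: "card (carrier M) = card (carrier R) ^ k"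
    using exists_finite_extension[OF fin \<open>0 < k\<close>] .
  interpret M: field M by fact
  interpret ring_hom_ring R M h using h by (intro ring_hom_ringI2 ring_axioms M.ring_axioms)
  let ?K = "h ` carrier R" and ?S = "M\<lparr>carrier := h ` carrier R\<rparr>"
  have inj: "inj_on h (carrier R)" and K: "subfield ?K M"
    using img_is_subfield[OF carrier_is_subfield M.one_not_zero] by auto
  have "finite (carrier M)"
    using card two_le_card_carrier_power[OF fin one_not_zero \<open>0 < k\<close>]
    by (intro card_ge_0_finite) linarith
  then have "has_max_period_lin_rec ?S k"
    using K card by (intro M.has_max_period_lin_rec_subfield) (simp_all add: card_image[OF inj])
  moreover have "R \<simeq> ?S"
    using h inj by (auto simp: is_ring_iso_def ring_iso_def ring_hom_def bij_betw_def)
  moreover have "ring ?S" using M.subring_is_ring[OF subfieldE(1)[OF K]] .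
  ultimately show ?thesis
    using has_max_period_lin_rec_iso ring_iso_sym[OF ring_axioms] ring_axioms by blast
qed

theorem theorem4p6:
  fixes Fs :: "('a ring) list" and k :: nat
  assumes "length Fs \<ge> 1"
    and "\<forall>F \<in> set Fs. field F \<and> finite (carrier F)"
    and "k \<ge> 1"
  shows "(\<exists>c a. lin_rec (RDirProd_list Fs) k c a \<and>
            least_period a = card (carrier (RDirProd_list Fs)) ^ k - 1)
         \<longleftrightarrow> length Fs = 1"
  unfolding has_max_period_lin_rec_def[symmetric]
proof
  have "ring F \<and> finite (carrier F) \<and> \<one>\<^bsub>F\<^esub> \<noteq> \<zero>\<^bsub>F\<^esub>" if "F \<in> set Fs" for F
    using assms(2) that by (metis field.is_ring field.axioms(1) domain.one_not_zero)
  moreover assume "has_max_period_lin_rec (RDirProd_list Fs) k"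
  ultimately have "\<not> 2 \<le> length Fs"
    using not_has_max_period_lin_rec_RDirProd_list assms(3) by fastforce
  then show "length Fs = 1" using assms(1) by simp
next
  assume "length Fs = 1"
  then obtain F where Fs: "Fs = [F]" by (auto simp: length_Suc_conv)
  then have F: "field F" "finite (carrier F)" using assms(2) by auto
  then have "has_max_period_lin_rec F k"
    using assms(3) by (intro field.has_max_period_lin_rec_finite_field) simp_all
  moreover have "ring F" using F(1) by (rule field.is_ring)
  moreover from this have "ring (RDirProd_list [F])" by (intro ring_RDirProd_list) simp
  ultimately show "has_max_period_lin_rec (RDirProd_list Fs) k"
    using has_max_period_lin_rec_iso RDirProd_list_singleton_iso unfolding Fs by blast
qed

end
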